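(* Let $\mathbb F$ be $\mathbb R$ or $\mathbb C$ and let $n<m$ be positive integers. Then $$P(m,n)=2M(m,n)+m=\frac{m^2}{n},$$ and $$M(m,n)=\frac{m(m-n)}{2n}.$$
   Context: Let $\mathbb F$ denote $\mathbb R$ or $\mathbb C$, and equip $\mathbb F^n$ with the standard inner product $\langle v,w\rangle=\sum_{i=1}^n v_i\overline{w_i}$ and norm $\|v\|=\langle v,v\rangle^{1/2}$. For positive integers $n<m$ define $$M(m,n)=\min\Big\{\sum_{1\le i<j\le m}|\langle v_i,v_j\rangle|^2 \;:\; v_1,\ldots,v_m\in\mathbb F^n,\ \|v_l\|=1 \text{ for all } 1\le l\le m\Big\},$$ $$P(m,n)=\min\Big\{\sum_{1\le i,j\le m}|\langle v_i,v_j\rangle|^2 \;:\; v_1,\ldots,v_m\in\mathbb F^n,\ \sum_{k=1}^m\|v_k\|^2=m\Big\}.$$ *)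

theory Defs
  imports "HOL-Analysis.Analysis"
begin

text \<open>
  A common signature for the scalar fields \<open>\<real>\<close> and \<open>\<complex>\<close>, so that the inner product and the two
  minima are each defined only once.  The library's \<open>\<bullet>\<close> on \<open>complex ^ 'n\<close> is the real part
  of the Hermitian product and cannot be used here.
\<close>

class conj_field = real_normed_field +
  fixes conjugate :: "'a \<Rightarrow> 'a"
  assumes conjugate_add: "conjugate (x + y) = conjugate x + conjugate y"
    and conjugate_scaleR: "conjugate (r *\<^sub>R x) = r *\<^sub>R conjugate x"
    and mult_conjugate_scaleR: "x * conjugate x = (norm x)\<^sup>2 *\<^sub>R 1"

instantiation real :: conj_field
begin
definition conjugate_real :: "real \<Rightarrow> real" where "conjugate_real x = x"
instance by standard (auto simp: conjugate_real_def power2_eq_square)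
end

instantiation complex :: conj_field
begin
definition conjugate_complex :: "complex \<Rightarrow> complex" where "conjugate_complex = cnj"
instance by standard
  (auto simp: conjugate_complex_def complex_norm_square[symmetric] scaleR_conv_of_real)
end

lemma mult_conjugate: "x * conjugate x = of_real ((norm (x :: 'a::conj_field))\<^sup>2)"
  by (simp add: mult_conjugate_scaleR scaleR_conv_of_real)

lemma norm_conjugate [simp]: "norm (conjugate x) = norm (x :: 'a::conj_field)"
proof -
  have "norm x * norm (conjugate x) = norm x * norm x"
    using arg_cong[OF mult_conjugate[of x], of norm]
    by (simp add: norm_mult power2_eq_square)
  moreover have "conjugate (0::'a) = 0"
    using conjugate_scaleR[of 0 "0::'a"] by simp
  ultimately show ?thesis by (cases "x = 0") auto
qed

lemma bounded_linear_conjugate: "bounded_linear (conjugate :: 'a \<Rightarrow> 'a::conj_field)"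
  by (rule bounded_linear_intro[where K = 1]) (auto simp: conjugate_add conjugate_scaleR)

definition hinner :: "'a::conj_field ^ 'n \<Rightarrow> 'a ^ 'n \<Rightarrow> 'a" where
  "hinner v w = (\<Sum>i\<in>UNIV. v $ i * conjugate (w $ i))"

lemma hinner_real: "hinner v w = v \<bullet> w" for v w :: "real ^ 'n"
  by (simp add: hinner_def conjugate_real_def inner_vec_def)

lemma hinner_complex: "hinner v w = (\<Sum>i\<in>UNIV. v $ i * cnj (w $ i))"
  by (simp add: hinner_def conjugate_complex_def)

text \<open>The library norm on \<open>'a ^ 'n\<close> is the one induced by \<open>hinner\<close>.\<close>

lemma hinner_self: "hinner v v = of_real ((norm v)\<^sup>2)"
  by (simp add: hinner_def mult_conjugate norm_vec_def L2_set_def sum_nonneg)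

text \<open>
  A system \<open>v\<^sub>1, \<dots>, v\<^sub>m\<close> is a function on \<open>nat\<close> of which only the values on \<open>{1..m}\<close> matter.
\<close>

definition pair_energy :: "nat \<Rightarrow> (nat \<Rightarrow> 'a::conj_field ^ 'n) \<Rightarrow> real" where
  "pair_energy m v = (\<Sum>(i, j)\<in>{(i, j). 1 \<le> i \<and> i < j \<and> j \<le> m}. (norm (hinner (v i) (v j)))\<^sup>2)"

definition frame_potential :: "nat \<Rightarrow> (nat \<Rightarrow> 'a::conj_field ^ 'n) \<Rightarrow> real" where
  "frame_potential m v = (\<Sum>i=1..m. \<Sum>j=1..m. (norm (hinner (v i) (v j)))\<^sup>2)"

text \<open>
  On \<open>real\<close>, \<open>LEAST r. Q r\<close> is the minimum of \<open>{r. Q r}\<close> provided that it is attained;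
  the lemmas \<open>min_pair_energy_attained\<close> and \<open>min_frame_potential_attained\<close> show that it is.
  The dimension is that of the type passed as first argument.
\<close>

definition min_pair_energy :: "('a::conj_field ^ 'n) itself \<Rightarrow> nat \<Rightarrow> real" where
  "min_pair_energy T m =
     (LEAST r. \<exists>v :: nat \<Rightarrow> 'a ^ 'n. (\<forall>l\<in>{1..m}. norm (v l) = 1) \<and> r = pair_energy m v)"

definition min_frame_potential :: "('a::conj_field ^ 'n) itself \<Rightarrow> nat \<Rightarrow> real" where
  "min_frame_potential T m =
     (LEAST r. \<exists>v :: nat \<Rightarrow> 'a ^ 'n. (\<Sum>k=1..m. (norm (v k))\<^sup>2) = real m \<and> r = frame_potential m v)"

lemma continuous_on_hinner:
  "continuous_on S (\<lambda>v :: nat \<Rightarrow> 'a::conj_field ^ 'n. hinner (v i) (v j))"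
proof -
  have coord: "continuous_on S (\<lambda>v :: nat \<Rightarrow> 'a ^ 'n. v k)" for k
    by (rule continuous_on_subset[OF continuous_on_product_coordinates]) simp
  show ?thesis
    unfolding hinner_def
    by (intro continuous_intros coord
          bounded_linear.continuous_on[OF bounded_linear_conjugate])
qed

lemma continuous_on_pair_energy:
  "continuous_on S (pair_energy m :: (nat \<Rightarrow> 'a::conj_field ^ 'n) \<Rightarrow> real)"
  unfolding pair_energy_def case_prod_unfold
  by (intro continuous_intros continuous_on_hinner)

lemma continuous_on_frame_potential:
  "continuous_on S (frame_potential m :: (nat \<Rightarrow> 'a::conj_field ^ 'n) \<Rightarrow> real)"
  unfolding frame_potential_def by (intro continuous_intros continuous_on_hinner)

lemma compact_systems:
  assumes "compact (S :: 'b::topological_space set)"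
  shows "compact {v :: nat \<Rightarrow> 'b. \<forall>i. v i \<in> S}"
proof -
  have "compactin (product_topology (\<lambda>i::nat. euclidean :: 'b topology) UNIV) (PiE UNIV (\<lambda>i. S))"
    using assms by (simp add: compactin_PiE)
  moreover have "PiE UNIV (\<lambda>i. S) = {v :: nat \<Rightarrow> 'b. \<forall>i. v i \<in> S}"
    by (auto simp: PiE_def)
  ultimately show ?thesis by (simp add: euclidean_product_topology)
qed

lemma pair_energy_cong: "(\<And>i. i \<in> {1..m} \<Longrightarrow> v i = w i) \<Longrightarrow> pair_energy m v = pair_energy m w"
  unfolding pair_energy_def by (intro sum.cong) auto

lemma frame_potential_cong:
  "(\<And>i. i \<in> {1..m} \<Longrightarrow> v i = w i) \<Longrightarrow> frame_potential m v = frame_potential m w"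
  unfolding frame_potential_def by (intro sum.cong) auto

lemma exists_unit_vector: "\<exists>u :: 'a::conj_field ^ 'n. norm u = 1"
proof -
  have "(norm (if P then 1 else 0 :: 'a))\<^sup>2 = (if P then 1 else 0)" for P by simp
  hence "norm (axis k 1 :: 'a ^ 'n) = 1" for k by (simp add: norm_vec_def L2_set_def axis_def)
  thus ?thesis by blast
qed

lemma min_pair_energy_attained:
  "\<exists>v :: nat \<Rightarrow> 'a::{conj_field, heine_borel} ^ 'n.
     (\<forall>l\<in>{1..m}. norm (v l) = 1) \<and> pair_energy m v = min_pair_energy TYPE('a ^ 'n) m \<and>
     (\<forall>w :: nat \<Rightarrow> 'a ^ 'n. (\<forall>l\<in>{1..m}. norm (w l) = 1) \<longrightarrow> pair_energy m v \<le> pair_energy m w)"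
proof -
  obtain u :: "'a ^ 'n" where u: "norm u = 1" using exists_unit_vector by blast
  let ?K = "{v :: nat \<Rightarrow> 'a ^ 'n. \<forall>i. v i \<in> sphere 0 1}"
  have "closed (sphere 0 1 :: ('a ^ 'n) set)" "bounded (sphere 0 1 :: ('a ^ 'n) set)"
    by (auto simp: bounded_iff)
  hence "compact ?K" by (intro compact_systems) (simp add: compact_eq_bounded_closed)
  moreover have "?K \<noteq> {}" using u by auto
  ultimately have "\<exists>v\<in>?K. \<forall>w\<in>?K. pair_energy m v \<le> pair_energy m w"
    by (rule continuous_attains_inf[OF _ _ continuous_on_pair_energy])
  then obtain v where v: "v \<in> ?K" "\<forall>w\<in>?K. pair_energy m v \<le> pair_energy m w"
    by (elim bexE)
  have min: "pair_energy m v \<le> pair_energy m w" if "\<forall>l\<in>{1..m}. norm (w l) = 1"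
    for w :: "nat \<Rightarrow> 'a ^ 'n"
  proof -
    have "pair_energy m w = pair_energy m (\<lambda>i. if i \<in> {1..m} then w i else u)"
      by (rule pair_energy_cong) simp
    moreover have "(\<lambda>i. if i \<in> {1..m} then w i else u) \<in> ?K" using that u by auto
    ultimately show ?thesis using v(2) by auto
  qed
  have "min_pair_energy TYPE('a ^ 'n) m = pair_energy m v"
    unfolding min_pair_energy_def using v(1) min by (intro Least_equality) auto
  thus ?thesis using v(1) min by (intro exI[of _ v]) auto
qed

lemma min_frame_potential_attained:
  "\<exists>v :: nat \<Rightarrow> 'a::{conj_field, heine_borel} ^ 'n.
     (\<Sum>k=1..m. (norm (v k))\<^sup>2) = real m \<and>
     frame_potential m v = min_frame_potential TYPE('a ^ 'n) m \<and>
     (\<forall>w :: nat \<Rightarrow> 'a ^ 'n. (\<Sum>k=1..m. (norm (w k))\<^sup>2) = real m \<longrightarrow>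
        frame_potential m v \<le> frame_potential m w)"
proof -
  obtain u :: "'a ^ 'n" where u: "norm u = 1" using exists_unit_vector by blast
  let ?N = "\<lambda>v :: nat \<Rightarrow> 'a ^ 'n. \<Sum>k=1..m. (norm (v k))\<^sup>2"
  let ?B = "{v :: nat \<Rightarrow> 'a ^ 'n. \<forall>i. v i \<in> cball 0 (sqrt m + 1)}"
  let ?K = "?B \<inter> {v. ?N v = real m}"
  have coord: "continuous_on UNIV (\<lambda>v :: nat \<Rightarrow> 'a ^ 'n. v k)" for k
    by (rule continuous_on_product_coordinates)
  have "closed {v. ?N v = real m}"
    by (intro closed_Collect_eq continuous_intros coord)
  hence "compact ?K" by (intro compact_Int_closed compact_systems compact_cball)
  moreover have "?K \<noteq> {}"
  proof -
    have "(\<lambda>_. u) \<in> ?K" using u by simp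
    thus ?thesis by (metis (no_types, lifting) empty_iff)
  qed
  ultimately have "\<exists>v\<in>?K. \<forall>w\<in>?K. frame_potential m v \<le> frame_potential m w"
    by (rule continuous_attains_inf[OF _ _ continuous_on_frame_potential])
  then obtain v where v: "v \<in> ?K" "\<forall>w\<in>?K. frame_potential m v \<le> frame_potential m w"
    by (elim bexE)
  have min: "frame_potential m v \<le> frame_potential m w" if w: "?N w = real m" for w
  proof -
    let ?w = "\<lambda>i. if i \<in> {1..m} then w i else 0"
    have "norm (w i) \<le> sqrt m + 1" if "i \<in> {1..m}" for i
    proof -
      have "(norm (w i))\<^sup>2 \<le> ?N w" using that by (intro member_le_sum) auto
      hence "norm (w i) \<le> sqrt m" using w real_le_rsqrt by auto
      thus ?thesis by simp
    qed
    moreover have "?N ?w = ?N w" by (intro sum.cong) auto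
    ultimately have "?w \<in> ?K" using w by auto
    moreover have "frame_potential m w = frame_potential m ?w"
      by (rule frame_potential_cong) simp
    ultimately show ?thesis using v(2) by auto
  qed
  have "min_frame_potential TYPE('a ^ 'n) m = frame_potential m v"
    unfolding min_frame_potential_def using v(1) min by (intro Least_equality) auto
  thus ?thesis using v(1) min by (intro exI[of _ v]) auto
qed

end

theory Submission
  imports Defs
begin

text \<open>
  Write \<open>S\<close> for the \<open>n \<times> n\<close> matrix \<open>S\<^sub>a\<^sub>b = \<Sum>\<^sub>i v\<^sub>i(a) \<sqdot> conjugate (v\<^sub>i(b))\<close> of the frame operator of a
  system \<open>v\<^sub>1, \<dots>, v\<^sub>m\<close>.  The Gram matrix and \<open>S\<close> have the same Hilbert--Schmidt norm, so the frame
  potential equals \<open>\<Sum>\<^sub>a\<^sub>b |S\<^sub>a\<^sub>b|\<^sup>2\<close> (\<open>frame_potential_eq_frame_operator\<close>).  The trace of \<open>S\<close> is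
  \<open>\<Sum>\<^sub>i \<parallel>v\<^sub>i\<parallel>\<^sup>2\<close>; discarding the off-diagonal entries and applying Cauchy--Schwarz to the \<open>n\<close>
  diagonal ones bounds the potential below by \<open>(\<Sum>\<^sub>i \<parallel>v\<^sub>i\<parallel>\<^sup>2)\<^sup>2 / n\<close>, which is the Welch bound
  (\<open>welch_bound\<close>).

  The bound is attained exactly when \<open>S\<close> is a scalar matrix, and a system of unit vectors with this
  property, a unit-norm tight frame, attains it under both constraints. An explicit one with real entries, which
  serves the real and the complex case at once, is \<open>v\<^sub>k(a) = (cos (2 \<pi> x\<^sub>a k / m) + sin (2 \<pi>
  x\<^sub>a k / m)) / \<surd>n\<close>, where the frequencies \<open>x\<^sub>a = a - (n - 1) / 2\<close> for \<open>a
  < n\<close> lie symmetrically about \<open>0\<close>. From \<open>(cos A + sin A) (cos B + sin B) = cos (A - B) +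
  sin (A + B)\<close> one reads off two facts. The rows of the frame are orthogonal, because \<open>x\<^sub>a -
  x\<^sub>b\<close> and \<open>x\<^sub>a + x\<^sub>b\<close> are integers, even where the frequencies are not, and so
  the sums over \<open>k\<close> are parts of sums of powers of an \<open>m\<close>-th root of unity; that root is not
  \<open>1\<close> for \<open>x\<^sub>a - x\<^sub>b\<close> with \<open>a \<noteq> b\<close>, because \<open>|a - b| <
  n \<le> m\<close> (\<open>hartley_rows_orthogonal\<close>). Its members are unit vectors, because in
  \<open>\<Sum>\<^sub>a (1 + sin (2 A\<^sub>a))\<close> the sines cancel by the symmetry of the frequencies
  (\<open>hartley_columns_normalized\<close>).

  For unit vectors the frame potential is twice the pair energy plus the \<open>m\<close> diagonal terms, so
  the value of one minimum gives that of the other.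
\<close>

section \<open>Conjugation\<close>

text \<open>
  The class axioms say nothing about the conjugate of a product or of a conjugate.  The following
  formula determines conjugation from the norm, and multiplicativity and involutivity are read off from it.
\<close>

lemma conjugate_eq: "conjugate x = of_real ((norm x)\<^sup>2) / (x :: 'a::conj_field)"
proof (cases "x = 0")
  case True
  then show ?thesis by (metis norm_conjugate norm_eq_zero div_by_0)
next
  case False
  then show ?thesis by (simp add: mult_conjugate[symmetric] del: of_real_power)
qed

lemma conjugate_mult: "conjugate (x * y) = conjugate x * conjugate (y :: 'a::conj_field)"
  by (simp add: conjugate_eq norm_mult power_mult_distrib)

lemma conjugate_conjugate: "conjugate (conjugate x) = (x :: 'a::conj_field)"
proof (cases "x = 0")
  case False
  have "conjugate (conjugate x) = of_real ((norm x)\<^sup>2) / conjugate x"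
    by (simp add: conjugate_eq[of "conjugate x"])
  also have "\<dots> = x" using False by (simp add: conjugate_eq)
  finally show ?thesis .
qed (simp add: conjugate_eq)

lemma conjugate_of_real: "conjugate (of_real r) = (of_real r :: 'a::conj_field)"
  using conjugate_scaleR[of r "1 :: 'a"] by (simp add: conjugate_eq[of 1] scaleR_conv_of_real)

lemma conjugate_sum: "conjugate (sum f A) = (\<Sum>i\<in>A. conjugate (f i :: 'a::conj_field))"
  by (rule linear_sum[OF bounded_linear.linear[OF bounded_linear_conjugate]])

lemma norm_hinner_commute:
  "norm (hinner w v) = norm (hinner v w)" for v w :: "'a::conj_field ^ 'n"
proof -
  have "hinner w v = conjugate (hinner v w)"
    by (simp add: hinner_def conjugate_sum conjugate_mult conjugate_conjugate mult.commute)
  then show ?thesis by simp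
qed

section \<open>The frame operator and the Welch bound\<close>

definition frame_operator :: "nat \<Rightarrow> (nat \<Rightarrow> 'a::conj_field ^ 'n) \<Rightarrow> 'n \<Rightarrow> 'n \<Rightarrow> 'a" where
  "frame_operator m v a b = (\<Sum>i=1..m. v i $ a * conjugate (v i $ b))"

text \<open>
  Expanded with \<open>|z|\<^sup>2 = z \<sqdot> conjugate z\<close>, both sides are the same fourfold sum; they differ only in
  whether the vector indices or the coordinate indices are summed inside the square.
\<close>

lemma frame_potential_eq_frame_operator:
  fixes v :: "nat \<Rightarrow> 'a::conj_field ^ 'n"
  shows "frame_potential m v = (\<Sum>a\<in>UNIV. \<Sum>b\<in>UNIV. (norm (frame_operator m v a b))\<^sup>2)"
proof -
  let ?t = "\<lambda>i j a b. v i $ a * conjugate (v j $ a) * (conjugate (v i $ b) * v j $ b)"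
  have gram: "of_real ((norm (hinner (v i) (v j)))\<^sup>2) = (\<Sum>a\<in>UNIV. \<Sum>b\<in>UNIV. ?t i j a b)" for i j
    by (simp only: mult_conjugate[symmetric] hinner_def conjugate_sum conjugate_mult
        conjugate_conjugate sum_product)
  have op: "of_real ((norm (frame_operator m v a b))\<^sup>2) = (\<Sum>i=1..m. \<Sum>j=1..m. ?t i j a b)" for a b
    by (simp only: mult_conjugate[symmetric] frame_operator_def conjugate_sum conjugate_mult
        conjugate_conjugate sum_product) (simp only: mult_ac)
  have "(of_real (frame_potential m v) :: 'a) = (\<Sum>i=1..m. \<Sum>j=1..m. \<Sum>a\<in>UNIV. \<Sum>b\<in>UNIV. ?t i j a b)"
    by (simp only: frame_potential_def of_real_sum gram)
  also have "\<dots> = (\<Sum>i=1..m. \<Sum>a\<in>UNIV. \<Sum>j=1..m. \<Sum>b\<in>UNIV. ?t i j a b)"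
    by (intro sum.cong refl sum.swap)
  also have "\<dots> = (\<Sum>a\<in>UNIV. \<Sum>i=1..m. \<Sum>j=1..m. \<Sum>b\<in>UNIV. ?t i j a b)"
    by (rule sum.swap)
  also have "\<dots> = (\<Sum>a\<in>UNIV. \<Sum>i=1..m. \<Sum>b\<in>UNIV. \<Sum>j=1..m. ?t i j a b)"
    by (intro sum.cong refl sum.swap)
  also have "\<dots> = (\<Sum>a\<in>UNIV. \<Sum>b\<in>UNIV. \<Sum>i=1..m. \<Sum>j=1..m. ?t i j a b)"
    by (intro sum.cong refl sum.swap)
  also have "\<dots> = of_real (\<Sum>a\<in>UNIV. \<Sum>b\<in>UNIV. (norm (frame_operator m v a b))\<^sup>2)"
    by (simp only: of_real_sum op)
  finally show ?thesis by (simp only: of_real_eq_iff)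
qed

lemma frame_operator_diagonal:
  "frame_operator m v a a = of_real (\<Sum>i=1..m. (norm (v i $ a))\<^sup>2)"
  by (simp add: frame_operator_def mult_conjugate)

lemma sum_norm_eq_frame_operator_trace:
  fixes v :: "nat \<Rightarrow> 'a::conj_field ^ 'n"
  shows "(\<Sum>a\<in>UNIV. norm (frame_operator m v a a)) = (\<Sum>i=1..m. (norm (v i))\<^sup>2)"
proof -
  have "(\<Sum>a\<in>UNIV. norm (frame_operator m v a a)) = (\<Sum>a\<in>UNIV. \<Sum>i=1..m. (norm (v i $ a))\<^sup>2)"
    by (simp only: frame_operator_diagonal norm_of_real) (simp add: sum_nonneg)
  also have "\<dots> = (\<Sum>i=1..m. \<Sum>a\<in>UNIV. (norm (v i $ a))\<^sup>2)"
    by (rule sum.swap)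
  also have "\<dots> = (\<Sum>i=1..m. (norm (v i))\<^sup>2)"
    by (simp add: norm_vec_def L2_set_def sum_nonneg)
  finally show ?thesis .
qed

lemma welch_bound:
  fixes v :: "nat \<Rightarrow> 'a::conj_field ^ 'n"
  shows "(\<Sum>i=1..m. (norm (v i))\<^sup>2)\<^sup>2 / real CARD('n) \<le> frame_potential m v"
proof -
  let ?S = "frame_operator m v"
  have "(\<Sum>a\<in>UNIV. norm (?S a a))\<^sup>2 \<le> (\<Sum>a\<in>UNIV. (norm (?S a a))\<^sup>2) * real CARD('n)"
    using sum_squared_le_sum_of_squares[of "\<lambda>a. norm (?S a a)" UNIV] by (simp add: mult.commute)
  moreover have "(\<Sum>a\<in>UNIV. (norm (?S a a))\<^sup>2) \<le> (\<Sum>a\<in>UNIV. \<Sum>b\<in>UNIV. (norm (?S a b))\<^sup>2)"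
    by (intro sum_mono member_le_sum) auto
  ultimately show ?thesis
    by (simp add: sum_norm_eq_frame_operator_trace frame_potential_eq_frame_operator divide_le_eq)
      (meson mult_right_mono of_nat_0_le_iff order_trans)
qed

text \<open>The diagonal terms contribute \<open>m\<close>, and each unordered pair is counted twice.\<close>

lemma frame_potential_eq_pair_energy:
  fixes v :: "nat \<Rightarrow> 'a::conj_field ^ 'n"
  assumes unit: "\<forall>l\<in>{1..m}. norm (v l) = 1"
  shows "frame_potential m v = 2 * pair_energy m v + real m"
proof -
  let ?g = "\<lambda>(i, j). (norm (hinner (v i) (v j)))\<^sup>2"
  let ?L = "{(i, j). 1 \<le> i \<and> i < j \<and> j \<le> m}"
  let ?U = "{(i, j). 1 \<le> j \<and> j < i \<and> i \<le> m}"
  let ?D = "(\<lambda>i. (i, i)) ` {1..m}"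
  have fin: "finite ?L" "finite ?U"
    by (rule finite_subset[of _ "{1..m} \<times> {1..m}"]; auto)+
  have "frame_potential m v = sum ?g ({1..m} \<times> {1..m})"
    by (simp add: frame_potential_def sum.cartesian_product)
  also have "{1..m} \<times> {1..m} = (?L \<union> ?U) \<union> ?D"
    by auto
  also have "sum ?g \<dots> = sum ?g ?L + sum ?g ?U + sum ?g ?D"
    using fin by (subst sum.union_disjoint; (subst sum.union_disjoint)?) auto
  also have "sum ?g ?U = sum ?g ?L"
    by (rule sum.reindex_bij_witness[of _ prod.swap prod.swap]) (auto simp: norm_hinner_commute)
  also have "sum ?g ?D = real m"
    using unit by (subst sum.reindex) (auto simp: inj_on_def hinner_self)
  also have "sum ?g ?L = pair_energy m v"
    by (simp add: pair_energy_def)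
  finally show ?thesis by simp
qed

section \<open>A unit-norm tight frame\<close>

lemma sum_powers_root_of_unity:
  fixes z :: "'a::field"
  assumes "z ^ m = 1"
  shows "(\<Sum>k=1..m. z ^ k) = (if z = 1 then of_nat m else 0)"
proof (cases "z = 1")
  case False
  have "(\<Sum>k=1..m. z ^ k) = z * (\<Sum>k<m. z ^ k)"
    by (simp add: sum.atLeast1_atMost_eq sum_distrib_left)
  then show ?thesis
    using False assms by (simp add: geometric_sum)
qed simp

context
  fixes m :: nat and p :: int
  assumes m: "0 < m"
begin

lemma sum_cis_integer_frequency:
  "(\<Sum>k=1..m. cis (2 * pi * of_int p * real k / real m)) =
    (if cis (2 * pi * of_int p / real m) = 1 then of_nat m else 0)"
proof -
  let ?z = "cis (2 * pi * of_int p / real m)"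
  have "?z ^ m = 1"
    using m cis_multiple_2pi[of "of_int p"] by (simp add: Complex.DeMoivre)
  moreover have "cis (2 * pi * of_int p * real k / real m) = ?z ^ k" for k
    by (simp add: Complex.DeMoivre mult_ac)
  ultimately show ?thesis
    by (simp only: sum_powers_root_of_unity)
qed

text \<open>Whether or not the root of unity is \<open>1\<close>, the sum of its powers is real.\<close>

lemma sum_sin_integer_frequency: "(\<Sum>k=1..m. sin (2 * pi * of_int p * real k / real m)) = 0"
  using arg_cong[OF sum_cis_integer_frequency, of Im] by (auto split: if_splits)

lemma sum_cos_integer_frequency:
  assumes "p \<noteq> 0" "\<bar>p\<bar> < int m"
  shows "(\<Sum>k=1..m. cos (2 * pi * of_int p * real k / real m)) = 0"
proof -
  have "cis (2 * pi * of_int p / real m) \<noteq> 1"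
  proof
    assume "cis (2 * pi * of_int p / real m) = 1"
    then have "cos (2 * pi * of_int p / real m) = 1"
      by (simp add: complex_eq_iff)
    then obtain q :: int where "2 * pi * of_int p / real m = of_int q * (2 * pi)"
      by (auto simp: cos_one_2pi_int)
    then have "real_of_int p = of_int (q * int m)"
      using m by (simp add: field_simps)
    then have "p = q * int m"
      by (simp only: of_int_eq_iff)
    then show False
      using assms dvd_imp_le_int[of p "int m"] by simp
  qed
  then show ?thesis
    using arg_cong[OF sum_cis_integer_frequency, of Re] by auto
qed

end

text \<open>
  The normalized Hartley kernel \<open>cos + sin\<close>.  The shift of the frequency \<open>a\<close> by \<open>(n - 1) / 2\<close>
  centres the frequencies \<open>0, \<dots>, n - 1\<close> at \<open>0\<close>, for even and odd \<open>n\<close> alike.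
\<close>

definition hartley_angle :: "nat \<Rightarrow> nat \<Rightarrow> nat \<Rightarrow> nat \<Rightarrow> real" where
  "hartley_angle m n k a = 2 * pi * (real a - (real n - 1) / 2) * real k / real m"

definition hartley :: "nat \<Rightarrow> nat \<Rightarrow> nat \<Rightarrow> nat \<Rightarrow> real" where
  "hartley m n k a = (cos (hartley_angle m n k a) + sin (hartley_angle m n k a)) / sqrt (real n)"

lemma hartley_mult:
  assumes "0 < n"
  shows "hartley m n k a * hartley m n k b =
    (cos (hartley_angle m n k a - hartley_angle m n k b) +
     sin (hartley_angle m n k a + hartley_angle m n k b)) / real n"
proof -
  have "sqrt (real n) * sqrt (real n) = real n" by simp
  then show ?thesis
    by (simp add: hartley_def cos_diff sin_add algebra_simps add_divide_distrib)
qed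

lemma hartley_rows_orthogonal:
  assumes "a < n" "b < n" "n \<le> m"
  shows "(\<Sum>k=1..m. hartley m n k a * hartley m n k b) = (if a = b then real m / real n else 0)"
proof -
  let ?d = "int a - int b" and ?s = "int a + int b - int n + 1"
  have diff: "hartley_angle m n k a - hartley_angle m n k b = 2 * pi * of_int ?d * real k / real m"
    and sum: "hartley_angle m n k a + hartley_angle m n k b = 2 * pi * of_int ?s * real k / real m" for k
    using assms by (simp_all add: hartley_angle_def field_simps)
  have "(\<Sum>k=1..m. hartley m n k a * hartley m n k b) =
    ((\<Sum>k=1..m. cos (2 * pi * of_int ?d * real k / real m)) +
     (\<Sum>k=1..m. sin (2 * pi * of_int ?s * real k / real m))) / real n"
    using assms by (simp only: hartley_mult diff sum sum.distrib flip: sum_divide_distrib)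
  also have "(\<Sum>k=1..m. sin (2 * pi * of_int ?s * real k / real m)) = 0"
    using assms by (intro sum_sin_integer_frequency) auto
  also have "(\<Sum>k=1..m. cos (2 * pi * of_int ?d * real k / real m)) = (if a = b then real m else 0)"
  proof (cases "a = b")
    case False
    then show ?thesis using assms by (subst sum_cos_integer_frequency) auto
  qed simp
  finally show ?thesis by simp
qed

lemma hartley_columns_normalized:
  assumes "0 < n"
  shows "(\<Sum>a<n. (hartley m n k a)\<^sup>2) = 1"
proof -
  let ?s = "\<lambda>a. sin (2 * hartley_angle m n k a)"
  have "sum ?s {..<n} = (\<Sum>a<n. ?s (n - Suc a))"
    by (rule sum.nat_diff_reindex[symmetric])
  also have "\<dots> = (\<Sum>a<n. - ?s a)"
  proof (rule sum.cong)
    fix a assume "a \<in> {..<n}"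
    then have "hartley_angle m n k (n - Suc a) = - hartley_angle m n k a"
      by (cases "m = 0") (simp_all add: hartley_angle_def of_nat_diff field_simps)
    then show "?s (n - Suc a) = - ?s a" by simp
  qed simp
  finally have "sum ?s {..<n} = 0"
    by (simp add: sum_negf)
  moreover have "(hartley m n k a)\<^sup>2 = (1 + ?s a) / real n" for a
    using hartley_mult[OF assms, of m k a a] by (simp add: power2_eq_square)
  ultimately show ?thesis
    using assms by (simp add: sum.distrib flip: sum_divide_distrib)
qed

text \<open>For this frame \<open>S\<close> is \<open>m / n\<close> times the identity, whence the potential \<open>n \<sqdot> (m / n)\<^sup>2\<close>.\<close>

lemma exists_unit_norm_tight_frame:
  assumes "CARD('n::finite) \<le> m"
  shows "\<exists>v :: nat \<Rightarrow> 'a::conj_field ^ 'n. (\<forall>i. norm (v i) = 1) \<and>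
    frame_potential m v = (real m)\<^sup>2 / real CARD('n)"
proof -
  let ?n = "CARD('n)"
  obtain h :: "'n \<Rightarrow> nat" where h: "bij_betw h UNIV {..<?n}"
    by (metis finite_class.finite_UNIV ex_bij_betw_finite_nat atLeast0LessThan)
  have lt: "h a < ?n" for a
    using h bij_betwE by fastforce
  have inj: "h a = h b \<longleftrightarrow> a = b" for a b
    using h by (auto simp: bij_betw_def inj_on_def)
  define v :: "nat \<Rightarrow> 'a ^ 'n" where "v k = (\<chi> a. of_real (hartley m ?n k (h a)))" for k
  have "(\<Sum>a\<in>UNIV. (norm (v k $ a))\<^sup>2) = 1" for k
  proof -
    have "(\<Sum>a\<in>UNIV. (norm (v k $ a))\<^sup>2) = (\<Sum>a\<in>UNIV. (hartley m ?n k (h a))\<^sup>2)"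
      by (simp add: v_def)
    also have "\<dots> = (\<Sum>a<?n. (hartley m ?n k a)\<^sup>2)"
      by (rule sum.reindex_bij_betw[OF h])
    finally show ?thesis by (simp add: hartley_columns_normalized)
  qed
  then have unit: "norm (v k) = 1" for k
    by (simp add: norm_vec_def L2_set_def)
  have "frame_operator m v a b = of_real (\<Sum>k=1..m. hartley m ?n k (h a) * hartley m ?n k (h b))" for a b
    by (simp add: frame_operator_def v_def conjugate_of_real)
  then have op: "frame_operator m v a b = of_real (if a = b then real m / real ?n else 0)" for a b
    using assms by (simp only: hartley_rows_orthogonal lt inj)
  have "(norm (frame_operator m v a b))\<^sup>2 = (if a = b then (real m / real ?n)\<^sup>2 else 0)" for a b
    by (simp add: op power_divide)
  then have "frame_potential m v = real ?n * (real m / real ?n)\<^sup>2"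
    by (simp add: frame_potential_eq_frame_operator)
  also have "\<dots> = (real m)\<^sup>2 / real ?n"
    by (simp add: power2_eq_square)
  finally show ?thesis using unit by blast
qed

section \<open>The two minima\<close>

lemma min_frame_potential_eq:
  assumes "CARD('n::finite) \<le> m"
  shows "min_frame_potential TYPE('a::conj_field ^ 'n) m = (real m)\<^sup>2 / real CARD('n)"
proof -
  obtain v :: "nat \<Rightarrow> 'a ^ 'n" where "\<forall>i. norm (v i) = 1"
    and "frame_potential m v = (real m)\<^sup>2 / real CARD('n)"
    using exists_unit_norm_tight_frame[OF assms] by blast
  then have "\<exists>w :: nat \<Rightarrow> 'a ^ 'n. (\<Sum>k=1..m. (norm (w k))\<^sup>2) = real m \<and>
      (real m)\<^sup>2 / real CARD('n) = frame_potential m w"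
    by (intro exI[of _ v]) simp
  moreover have "(real m)\<^sup>2 / real CARD('n) \<le> frame_potential m w"
    if "(\<Sum>k=1..m. (norm (w k))\<^sup>2) = real m" for w :: "nat \<Rightarrow> 'a ^ 'n"
    using welch_bound[of w m] that by simp
  ultimately show ?thesis
    unfolding min_frame_potential_def by (intro Least_equality) blast+
qed

lemma min_pair_energy_eq:
  assumes "CARD('n::finite) \<le> m"
  shows "2 * min_pair_energy TYPE('a::conj_field ^ 'n) m + real m = (real m)\<^sup>2 / real CARD('n)"
proof -
  obtain v :: "nat \<Rightarrow> 'a ^ 'n" where unit: "\<forall>i. norm (v i) = 1"
    and v: "frame_potential m v = (real m)\<^sup>2 / real CARD('n)"
    using exists_unit_norm_tight_frame[OF assms] by blast
  have "min_pair_energy TYPE('a ^ 'n) m = pair_energy m v"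
    unfolding min_pair_energy_def
  proof (rule Least_equality)
    fix r assume "\<exists>w :: nat \<Rightarrow> 'a ^ 'n. (\<forall>l\<in>{1..m}. norm (w l) = 1) \<and> r = pair_energy m w"
    then obtain w :: "nat \<Rightarrow> 'a ^ 'n" where w: "\<forall>l\<in>{1..m}. norm (w l) = 1" "r = pair_energy m w"
      by blast
    then have "frame_potential m v \<le> frame_potential m w"
      using welch_bound[of w m] v by simp
    then show "pair_energy m v \<le> r"
      using frame_potential_eq_pair_energy[of m v] frame_potential_eq_pair_energy[OF w(1)] unit w(2)
      by simp
  qed (use unit in auto)
  then show ?thesis
    using frame_potential_eq_pair_energy[of m v] unit v by simp
qed

theorem corollary2:
  fixes m n :: nat
  assumes "CARD('n::finite) = n" and "0 < n" and "n < m"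
  shows
    "(min_frame_potential TYPE(real ^ 'n) m = 2 * min_pair_energy TYPE(real ^ 'n) m + real m \<and>
      2 * min_pair_energy TYPE(real ^ 'n) m + real m = (real m)\<^sup>2 / real n \<and>
      min_pair_energy TYPE(real ^ 'n) m = real m * (real m - real n) / (2 * real n)) \<and>
     (min_frame_potential TYPE(complex ^ 'n) m = 2 * min_pair_energy TYPE(complex ^ 'n) m + real m \<and>
      2 * min_pair_energy TYPE(complex ^ 'n) m + real m = (real m)\<^sup>2 / real n \<and>
      min_pair_energy TYPE(complex ^ 'n) m = real m * (real m - real n) / (2 * real n))"
proof -
  have le: "CARD('n) \<le> m"
    using assms by simp
  have solve: "x = real m * (real m - real n) / (2 * real n)"
    if "2 * x + real m = (real m)\<^sup>2 / real n" for x
    using that assms(2) by (simp add: field_simps power2_eq_square)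
  show ?thesis
    using min_frame_potential_eq[OF le, where 'a = real] min_pair_energy_eq[OF le, where 'a = real]
      min_frame_potential_eq[OF le, where 'a = complex] min_pair_energy_eq[OF le, where 'a = complex]
      solve assms(1) by simp
qed

end
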